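(* Let $G$ be a locally compact group, $\omega$ a weight function on $G$, and $\omega'(x)=\omega(x^{-1})$ for $x\in G$. Then $L^1(G,\omega')$ is weakly amenable if and only if $L^1(G,\omega)$ is weakly amenable.
   Context: A weight function on $G$ is a continuous $\omega:G\to[1,\infty)$ with $\omega(xy)\le\omega(x)\omega(y)$ and $\omega(e)=1$ ($\omega'$ is again a weight). $L^1(G,\omega)$ is the Banach algebra under convolution of Borel $f$ with $\int|f|\omega\,dx<\infty$ (left Haar measure). A Banach algebra $A$ is weakly amenable if every bounded derivation $D:A\to A^*$ is inner. *)

theory Defs
  imports "HOL-Analysis.Analysis"
begin

text \<open>The group is a type of class group_add (written additively, NOT assumed
commutative); x\<inverse> is -x and xy is x + y.\<close>

definition locally_compact_group :: "'a::{t2_space, group_add} itself \<Rightarrow> bool" where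
  "locally_compact_group (_::'a itself) \<longleftrightarrow>
     continuous_on UNIV (\<lambda>p::'a \<times> 'a. fst p + snd p) \<and>
     continuous_on UNIV (\<lambda>x::'a. - x) \<and>
     (\<forall>x::'a. \<exists>U K. open U \<and> compact K \<and> x \<in> U \<and> U \<subseteq> K)"

definition left_haar_measure :: "'a::{t2_space, group_add} measure \<Rightarrow> bool" where
  "left_haar_measure \<mu> \<longleftrightarrow>
     sets \<mu> = sets borel \<and>
     (\<forall>x. \<forall>A\<in>sets borel. emeasure \<mu> ((\<lambda>y. x + y) ` A) = emeasure \<mu> A) \<and>
     (\<forall>K. compact K \<longrightarrow> emeasure \<mu> K < \<infinity>) \<and>
     (\<forall>U. open U \<and> U \<noteq> {} \<longrightarrow> emeasure \<mu> U > 0) \<and>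
     (\<forall>A\<in>sets borel. emeasure \<mu> A = (INF U\<in>{U. open U \<and> A \<subseteq> U}. emeasure \<mu> U)) \<and>
     (\<forall>U. open U \<longrightarrow> emeasure \<mu> U = (SUP K\<in>{K. compact K \<and> K \<subseteq> U}. emeasure \<mu> K))"

definition weight_function :: "('a::{topological_space, group_add} \<Rightarrow> real) \<Rightarrow> bool" where
  "weight_function \<omega> \<longleftrightarrow> continuous_on UNIV \<omega> \<and> (\<forall>x. 1 \<le> \<omega> x) \<and>
     (\<forall>x y. \<omega> (x + y) \<le> \<omega> x * \<omega> y) \<and> \<omega> 0 = 1"

text \<open>Representatives of elements of L^1(G,\<omega>) (classes modulo a.e. equality are
handled implicitly: all notions below are invariant under null modifications).\<close>
definition L1w :: "'a::{topological_space, group_add} measure \<Rightarrow> ('a \<Rightarrow> real) \<Rightarrow> ('a \<Rightarrow> complex) set" where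
  "L1w \<mu> \<omega> = {f. f \<in> borel_measurable \<mu> \<and> integrable \<mu> (\<lambda>x. norm (f x) * \<omega> x)}"

definition L1norm :: "'a::{topological_space, group_add} measure \<Rightarrow> ('a \<Rightarrow> real) \<Rightarrow> ('a \<Rightarrow> complex) \<Rightarrow> real" where
  "L1norm \<mu> \<omega> f = (\<integral>x. norm (f x) * \<omega> x \<partial>\<mu>)"

definition conv :: "'a::{topological_space, group_add} measure \<Rightarrow> ('a \<Rightarrow> complex) \<Rightarrow> ('a \<Rightarrow> complex) \<Rightarrow> ('a \<Rightarrow> complex)" where
  "conv \<mu> f g = (\<lambda>x. \<integral>y. f y * g (- y + x) \<partial>\<mu>)"

definition in_dual :: "'a::{topological_space, group_add} measure \<Rightarrow> ('a \<Rightarrow> real) \<Rightarrow> (('a \<Rightarrow> complex) \<Rightarrow> complex) \<Rightarrow> bool" where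
  "in_dual \<mu> \<omega> \<phi> \<longleftrightarrow>
     (\<forall>f\<in>L1w \<mu> \<omega>. \<forall>g\<in>L1w \<mu> \<omega>. \<phi> (\<lambda>x. f x + g x) = \<phi> f + \<phi> g) \<and>
     (\<forall>c. \<forall>f\<in>L1w \<mu> \<omega>. \<phi> (\<lambda>x. c * f x) = c * \<phi> f) \<and>
     (\<exists>K. \<forall>f\<in>L1w \<mu> \<omega>. norm (\<phi> f) \<le> K * L1norm \<mu> \<omega> f)"

text \<open>Bounded derivation D : A \<rightarrow> A*, with module actions
 (a\<cdot>\<phi>)(b) = \<phi>(b a) and (\<phi>\<cdot>a)(b) = \<phi>(a b); D(ab) = a\<cdot>D(b) + D(a)\<cdot>b.\<close>
definition bounded_derivation :: "'a::{topological_space, group_add} measure \<Rightarrow> ('a \<Rightarrow> real) \<Rightarrow>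
    (('a \<Rightarrow> complex) \<Rightarrow> ('a \<Rightarrow> complex) \<Rightarrow> complex) \<Rightarrow> bool" where
  "bounded_derivation \<mu> \<omega> D \<longleftrightarrow>
     (\<forall>f\<in>L1w \<mu> \<omega>. in_dual \<mu> \<omega> (D f)) \<and>
     (\<forall>f\<in>L1w \<mu> \<omega>. \<forall>g\<in>L1w \<mu> \<omega>. \<forall>h\<in>L1w \<mu> \<omega>. D (\<lambda>x. f x + g x) h = D f h + D g h) \<and>
     (\<forall>c. \<forall>f\<in>L1w \<mu> \<omega>. \<forall>h\<in>L1w \<mu> \<omega>. D (\<lambda>x. c * f x) h = c * D f h) \<and>
     (\<exists>C. \<forall>f\<in>L1w \<mu> \<omega>. \<forall>h\<in>L1w \<mu> \<omega>. norm (D f h) \<le> C * L1norm \<mu> \<omega> f * L1norm \<mu> \<omega> h) \<and>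
     (\<forall>f\<in>L1w \<mu> \<omega>. \<forall>g\<in>L1w \<mu> \<omega>. \<forall>h\<in>L1w \<mu> \<omega>.
        D (conv \<mu> f g) h = D g (conv \<mu> h f) + D f (conv \<mu> g h))"

text \<open>Inner derivation: D = ad_\<phi>, D(a) = a\<cdot>\<phi> - \<phi>\<cdot>a, as functionals on A.\<close>
definition inner_derivation :: "'a::{topological_space, group_add} measure \<Rightarrow> ('a \<Rightarrow> real) \<Rightarrow>
    (('a \<Rightarrow> complex) \<Rightarrow> ('a \<Rightarrow> complex) \<Rightarrow> complex) \<Rightarrow> bool" where
  "inner_derivation \<mu> \<omega> D \<longleftrightarrow>
     (\<exists>\<phi>. in_dual \<mu> \<omega> \<phi> \<and>
        (\<forall>f\<in>L1w \<mu> \<omega>. \<forall>h\<in>L1w \<mu> \<omega>. D f h = \<phi> (conv \<mu> h f) - \<phi> (conv \<mu> f h)))"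

definition weakly_amenable_L1 :: "'a::{topological_space, group_add} measure \<Rightarrow> ('a \<Rightarrow> real) \<Rightarrow> bool" where
  "weakly_amenable_L1 \<mu> \<omega> \<longleftrightarrow>
     (\<forall>D. bounded_derivation \<mu> \<omega> D \<longrightarrow> inner_derivation \<mu> \<omega> D)"

end

theory Submission
  imports Defs
begin

text \<open>
  With the modular function \<open>\<Delta>\<close>, the map \<open>f \<mapsto> f~\<close>, \<open>f~(x) = f(x\<inverse>) \<Delta>(x\<inverse>)\<close>, is a bounded
  involutive anti-isomorphism between \<open>L\<^sup>1(G,\<omega>')\<close> and \<open>L\<^sup>1(G,\<omega>)\<close>. It turns a derivation \<open>D\<close>
  into the derivation \<open>E f h = D f~ h~\<close>, and if \<open>E\<close> is implemented by \<open>\<phi>\<close> then \<open>D\<close> is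
  implemented by \<open>f \<mapsto> - \<phi> f~\<close>.

  For \<open>f\<close>, \<open>g\<close> continuous with compact support, exchanging integrals and left invariance give
  \<open>\<integral> f(x) G(x) dx = (\<integral> g) (\<integral> f(x\<inverse>) dx)\<close> where \<open>G(x) = \<integral> g(yx) dy\<close>. Hence \<open>G / \<integral> g\<close> is the continuous
  density of the reflected measure and does not depend on \<open>g\<close>; replacing \<open>g\<close> by a right translate
  shows that it is multiplicative. The measure need not be \<open>\<sigma>\<close>-finite and the Borel sets of
  \<open>G \<times> G\<close> may exceed the product \<open>\<sigma>\<close>-algebra, so the exchange of integrals is proved directly
  for continuous functions of compact support. For general integrable functions the inequality
  \<open>\<integral> f(x\<inverse>) \<Delta>(x\<inverse>) dx \<le> 4 \<integral> f(x) dx\<close>, \<open>f \<ge> 0\<close>, is all that weak amenability requires.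
\<close>

section \<open>Integrals of continuous functions of compact support\<close>

lemma integrable_continuous_compact_support:
  fixes f :: "'a::t2_space \<Rightarrow> real"
  assumes M: "sets M = sets borel" and fin: "emeasure M K < \<infinity>" and K: "compact K"
    and f: "continuous_on UNIV f" and supp: "\<And>x. x \<notin> K \<Longrightarrow> f x = 0"
  shows "integrable M f"
proof -
  have "bounded (f ` K)"
    using K f by (intro compact_imp_bounded compact_continuous_image continuous_on_subset[OF f]) auto
  then obtain B where B: "\<And>x. x \<in> K \<Longrightarrow> norm (f x) \<le> B"
    unfolding bounded_iff by auto
  have meas: "f \<in> borel_measurable M"
    using borel_measurable_continuous_onI[OF f] M by (simp cong: measurable_cong_sets)
  have "K \<in> sets M"
    using K M by (simp add: borel_closed compact_imp_closed)
  then show ?thesis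
    using B supp by (intro integrableI_bounded_set[OF _ meas fin, of B]) auto
qed

text \<open>The set where \<open>h p\<close> is within \<open>e\<close> of
  \<open>h (y0, snd p)\<close> is open and contains \<open>{y0} \<times> K\<close>, so the tube
  lemma applies. This replaces uniform continuity, as the parameter space carries only a
  topology.\<close>

lemma tube_lemma_dist:
  fixes h :: "'b::topological_space \<times> 'a::topological_space \<Rightarrow> real"
  assumes h: "continuous_on UNIV h" and K: "compact K" and e: "e > 0"
  shows "\<exists>U. open U \<and> y0 \<in> U \<and> (\<forall>y\<in>U. \<forall>x\<in>K. \<bar>h (y, x) - h (y0, x)\<bar> < e)"
proof -
  let ?W = "{p. \<bar>h p - h (y0, snd p)\<bar> < e}"
  have "continuous_on UNIV (\<lambda>p. h (y0, snd p))"
    by (intro continuous_on_compose2[OF h] continuous_intros) auto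
  then have W: "open ?W"
    using h by (intro open_Collect_less continuous_intros) auto
  have sub: "{y0} \<times> K \<subseteq> ?W"
    using e by auto
  obtain U where U: "y0 \<in> U" "open U" "U \<times> K \<subseteq> ?W"
    using Elementary_Topology.tube_lemma[OF K W sub] by (elim exE conjE)
  have "\<bar>h (y, x) - h (y0, x)\<bar> < e" if "y \<in> U" "x \<in> K" for x y
    using subsetD[OF U(3), of "(y, x)"] that by simp
  then show ?thesis
    using U by blast
qed

text \<open>Near \<open>y0\<close> all integrands live on one compact set and are uniformly close
  there. The compact set may depend on \<open>y0\<close>, since the support of a translate moves
  with the parameter. The factor \<open>indicator A\<close> allows integration over the Borel pieces
  into which a compact set is cut for the exchange of integrals.\<close>

lemma continuous_on_parametric_integral:
  fixes h :: "'b::t2_space \<times> 'a::t2_space \<Rightarrow> real"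
  assumes M: "sets M = sets borel" and fin: "\<And>K. compact K \<Longrightarrow> emeasure M K < \<infinity>"
    and h: "continuous_on UNIV h" and A: "A \<in> sets M"
    and supp: "\<And>y0. \<exists>U K. open U \<and> y0 \<in> U \<and> compact K \<and> (\<forall>y\<in>U. \<forall>x. x \<notin> K \<longrightarrow> h (y, x) = 0)"
  shows "continuous_on UNIV (\<lambda>y. \<integral>x. indicator A x * h (y, x) \<partial>M)"
proof -
  have spM [simp]: "space M = UNIV"
    using sets_eq_imp_space_eq[OF M] by simp
  have "isCont (\<lambda>y. \<integral>x. indicator A x * h (y, x) \<partial>M) y0" for y0
    unfolding isCont_def
  proof (rule tendstoI)
    fix e :: real assume "e > 0"
    obtain U K where U: "open U" "y0 \<in> U" and K: "compact K"
      and z: "\<And>y x. y \<in> U \<Longrightarrow> x \<notin> K \<Longrightarrow> h (y, x) = 0"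
      using supp[of y0] by blast
    have Ks: "K \<in> sets M"
      using K M by (simp add: borel_closed compact_imp_closed)
    \<comment> \<open>The summand 1 keeps the denominator positive when \<open>K\<close> is a null
      set.\<close>
    define e' where "e' = e / (measure M K + 1)"
    have e': "e' > 0" "e' * measure M K < e"
      using \<open>e > 0\<close> by (auto simp: e'_def field_simps add_nonneg_pos add_pos_nonneg)
    obtain V where V: "open V" "y0 \<in> V" and Vd: "\<And>y x. y \<in> V \<Longrightarrow> x \<in> K \<Longrightarrow> \<bar>h (y, x) - h (y0, x)\<bar> < e'"
      using tube_lemma_dist[OF h K e'(1), of y0] by blast
    have int: "integrable M (\<lambda>x. indicator A x * h (y, x))" if "y \<in> U" for y
    proof -
      have "integrable M (\<lambda>x. h (y, x))"
        using z[OF that] by (intro integrable_continuous_compact_support[OF M fin[OF K] K]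
            continuous_on_compose2[OF h] continuous_intros) auto
      from integrable_mult_indicator[OF A this] show ?thesis
        by simp
    qed
    have "dist (\<integral>x. indicator A x * h (y, x) \<partial>M) (\<integral>x. indicator A x * h (y0, x) \<partial>M) < e"
      if y: "y \<in> U \<inter> V" for y
    proof -
      have "\<bar>(\<integral>x. indicator A x * h (y, x) \<partial>M) - (\<integral>x. indicator A x * h (y0, x) \<partial>M)\<bar>
          = \<bar>\<integral>x. indicator A x * h (y, x) - indicator A x * h (y0, x) \<partial>M\<bar>"
        using int y U by simp
      also have "\<dots> \<le> (\<integral>x. \<bar>indicator A x * h (y, x) - indicator A x * h (y0, x)\<bar> \<partial>M)"
        by simp
      also have "\<dots> \<le> (\<integral>x. e' * indicator K x \<partial>M)"
      proof (rule integral_mono)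
        show "integrable M (\<lambda>x. \<bar>indicator A x * h (y, x) - indicator A x * h (y0, x)\<bar>)"
          using int y U by simp
        show "integrable M (\<lambda>x. e' * indicator K x)"
          using fin[OF K] Ks by simp
        show "\<bar>indicator A x * h (y, x) - indicator A x * h (y0, x)\<bar> \<le> e' * indicator K x" for x
          using Vd[of y x] z[of y x] z[of y0 x] y U e'(1) by (auto simp: indicator_def)
      qed
      also have "\<dots> = e' * measure M K"
        using Ks by simp
      finally show ?thesis
        using e'(2) by (simp add: dist_real_def)
    qed
    then show "\<forall>\<^sub>F y in at y0. dist (\<integral>x. indicator A x * h (y, x) \<partial>M) (\<integral>x. indicator A x * h (y0, x) \<partial>M) < e"
      using U V unfolding eventually_at_topological by (meson IntI open_Int)
  qed
  then show ?thesis
    by (simp add: continuous_at_imp_continuous_on)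
qed

text \<open>Cut \<open>K\<close> into finitely many disjoint Borel pieces on each of which
  \<open>h (x, y)\<close> is nearly independent of \<open>x\<close>, uniformly in
  \<open>y \<in> L\<close>. On a piece, both iterated integrals are close to the measure of the
  piece times \<open>a z\<close> for one point \<open>z\<close>. No product measure enters.\<close>

lemma Fubini_continuous_compact_support:
  fixes h :: "'b::t2_space \<times> 'a::t2_space \<Rightarrow> real"
  assumes M: "sets M = sets borel" and finM: "\<And>K. compact K \<Longrightarrow> emeasure M K < \<infinity>"
    and N: "sets N = sets borel" and finN: "\<And>K. compact K \<Longrightarrow> emeasure N K < \<infinity>"
    and h: "continuous_on UNIV h" and K: "compact K" and L: "compact L"
    and supp: "\<And>x y. x \<notin> K \<or> y \<notin> L \<Longrightarrow> h (x, y) = 0"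
  shows "(\<integral>x. \<integral>y. h (x, y) \<partial>N \<partial>M) = (\<integral>y. \<integral>x. h (x, y) \<partial>M \<partial>N)"
proof -
  have spM [simp]: "space M = UNIV" and spN [simp]: "space N = UNIV"
    using sets_eq_imp_space_eq[OF M] sets_eq_imp_space_eq[OF N] by simp_all
  define a where "a x = (\<integral>y. h (x, y) \<partial>N)" for x
  define b where "b A y = (\<integral>x. indicator A x * h (x, y) \<partial>M)" for A y
  have Ks: "K \<in> sets M" and Ls: "L \<in> sets N"
    using K L M N by (simp_all add: borel_closed compact_imp_closed)
  have finK: "emeasure M K < \<infinity>" and finL: "emeasure N L < \<infinity>"
    using K L finM finN by auto
  have inth1: "integrable M (\<lambda>x. h (x, y))" for y
    using supp by (intro integrable_continuous_compact_support[OF M finK K]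
        continuous_on_compose2[OF h] continuous_intros) auto
  have inth2: "integrable N (\<lambda>y. h (x, y))" for x
    using supp by (intro integrable_continuous_compact_support[OF N finL L]
        continuous_on_compose2[OF h] continuous_intros) auto
  have intAh: "integrable M (\<lambda>x. indicator A x * h (x, y))" if "A \<in> sets M" for A y
    using integrable_mult_indicator[OF that inth1] by simp
  have "continuous_on UNIV (\<lambda>x. \<integral>y. indicator UNIV y * h (x, y) \<partial>N)"
  proof (rule continuous_on_parametric_integral[OF N finN h])
    show "\<exists>U K. open U \<and> x0 \<in> U \<and> compact K \<and> (\<forall>x\<in>U. \<forall>y. y \<notin> K \<longrightarrow> h (x, y) = 0)" for x0
      using L supp by (intro exI[of _ UNIV] exI[of _ L]) auto
  qed (use N in auto)
  then have "continuous_on UNIV a"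
    by (simp add: a_def[abs_def])
  moreover have a0: "a x = 0" if "x \<notin> K" for x
    using supp that by (simp add: a_def)
  ultimately have inta: "integrable M a"
    by (intro integrable_continuous_compact_support[OF M finK K])
  then have intAa: "integrable M (\<lambda>x. indicator A x * a x)" if "A \<in> sets M" for A
    using integrable_mult_indicator[OF that inta] by simp
  have h': "continuous_on UNIV (\<lambda>p. h (snd p, fst p))"
    by (intro continuous_on_compose2[OF h] continuous_intros) auto
  have intb: "integrable N (b A)" if A: "A \<in> sets M" for A
  proof (rule integrable_continuous_compact_support[OF N finL L])
    show "continuous_on UNIV (b A)"
      unfolding b_def
    proof (rule continuous_on_parametric_integral[OF M finM h' A, unfolded fst_conv snd_conv])
      show "\<exists>U L. open U \<and> y0 \<in> U \<and> compact L \<and> (\<forall>y\<in>U. \<forall>x. x \<notin> L \<longrightarrow> h (x, y) = 0)" for y0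
        using K supp by (intro exI[of _ UNIV] exI[of _ K]) auto
    qed
    show "b A y = 0" if "y \<notin> L" for y
      using supp that by (simp add: b_def)
  qed
  \<comment> \<open>Induction over the finite cover. The factor 2 arises because both iterated
    integrals are compared with a common value; the error is proportional to
    \<open>measure M A\<close>, so it adds up over pieces without depending on their number.\<close>
  have bound: "\<bar>(\<integral>x. indicator A x * a x \<partial>M) - (\<integral>y. b A y \<partial>N)\<bar> \<le> 2 * e * measure N L * measure M A"
    if e: "e > 0" and F: "finite F" and U: "\<And>z x y. z \<in> F \<Longrightarrow> x \<in> U z \<Longrightarrow> y \<in> L \<Longrightarrow> \<bar>h (x, y) - h (z, y)\<bar> < e"
      and op: "\<And>z. z \<in> F \<Longrightarrow> open (U z)" and A: "A \<in> sets M" "A \<subseteq> K" "A \<subseteq> (\<Union>z\<in>F. U z)" for A F U e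
    using F U op A
  proof (induction F arbitrary: A)
    case empty
    then show ?case by (simp add: b_def)
  next
    case (insert z F)
    \<comment> \<open>\<open>B\<close> is the piece on which sections of \<open>h\<close> are
      compared with the section at \<open>z\<close>; the rest \<open>C\<close> is covered by the
      other open sets and falls to the induction hypothesis.\<close>
    define B where "B = A \<inter> U z"
    define C where "C = A - U z"
    have Us: "U z \<in> sets M"
      using insert.prems(2)[of z] M by simp
    have Bs: "B \<in> sets M" "B \<subseteq> K" and Cs: "C \<in> sets M" "C \<subseteq> K" "C \<subseteq> (\<Union>z\<in>F. U z)"
      using Us insert.prems by (auto simp: B_def C_def)
    have fin: "emeasure M S < \<infinity>" if "S \<subseteq> K" for S
      using emeasure_mono[OF that Ks] finK by (simp add: order_le_less_trans)
    have ind: "indicator A x = (indicator B x + indicator C x :: real)" for x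
      by (auto simp: B_def C_def indicator_def)
    have IC: "\<bar>(\<integral>x. indicator C x * a x \<partial>M) - (\<integral>y. b C y \<partial>N)\<bar> \<le> 2 * e * measure N L * measure M C"
      using insert.IH[of C] insert.prems Cs by blast
    have indB: "integrable M (\<lambda>x. indicator B x :: real)"
      using Bs fin by simp
    have cl: "\<bar>h (x, y) - h (z, y)\<bar> \<le> e * indicator L y" if "x \<in> B" for x y
      using insert.prems(1)[of z x y] that supp[of x y] supp[of z y] e
      by (cases "y \<in> L") (auto simp: B_def)
    have "\<bar>(\<integral>x. indicator B x * a x \<partial>M) - measure M B * a z\<bar> = \<bar>\<integral>x. indicator B x * (a x - a z) \<partial>M\<bar>"
      using intAa[OF Bs(1)] indB by (simp add: right_diff_distrib)
    also have "\<dots> \<le> (\<integral>x. \<bar>indicator B x * (a x - a z)\<bar> \<partial>M)"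
      by simp
    also have "\<dots> \<le> (\<integral>x. indicator B x * (e * measure N L) \<partial>M)"
    proof (rule integral_mono)
      show "integrable M (\<lambda>x. \<bar>indicator B x * (a x - a z)\<bar>)"
        using intAa[OF Bs(1)] indB by (simp add: right_diff_distrib)
      show "integrable M (\<lambda>x. indicator B x * (e * measure N L))"
        using indB by simp
      show "\<bar>indicator B x * (a x - a z)\<bar> \<le> indicator B x * (e * measure N L)" for x
      proof (cases "x \<in> B")
        case True
        have "\<bar>a x - a z\<bar> = \<bar>\<integral>y. h (x, y) - h (z, y) \<partial>N\<bar>"
          unfolding a_def using inth2 by simp
        also have "\<dots> \<le> (\<integral>y. \<bar>h (x, y) - h (z, y)\<bar> \<partial>N)"
          by simp
        also have "\<dots> \<le> (\<integral>y. e * indicator L y \<partial>N)"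
          using inth2 finL Ls cl[OF True] by (intro integral_mono) auto
        finally show ?thesis
          using True Ls by simp
      qed simp
    qed
    also have "\<dots> = e * measure N L * measure M B"
      using Bs by simp
    finally have 1: "\<bar>(\<integral>x. indicator B x * a x \<partial>M) - measure M B * a z\<bar> \<le> e * measure N L * measure M B" .
    have "\<bar>(\<integral>y. b B y \<partial>N) - measure M B * a z\<bar> = \<bar>\<integral>y. b B y - measure M B * h (z, y) \<partial>N\<bar>"
      unfolding a_def using inth2 intb[OF Bs(1)] by simp
    also have "\<dots> \<le> (\<integral>y. \<bar>b B y - measure M B * h (z, y)\<bar> \<partial>N)"
      by simp
    also have "\<dots> \<le> (\<integral>y. (e * measure M B) * indicator L y \<partial>N)"
    proof (rule integral_mono)
      show "integrable N (\<lambda>y. \<bar>b B y - measure M B * h (z, y)\<bar>)"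
        using inth2 intb[OF Bs(1)] by simp
      show "integrable N (\<lambda>y. (e * measure M B) * indicator L y)"
        using finL Ls by simp
      show "\<bar>b B y - measure M B * h (z, y)\<bar> \<le> (e * measure M B) * indicator L y" for y
      proof -
        have "\<bar>b B y - measure M B * h (z, y)\<bar> = \<bar>\<integral>x. indicator B x * (h (x, y) - h (z, y)) \<partial>M\<bar>"
          unfolding b_def using intAh[OF Bs(1)] indB by (simp add: right_diff_distrib)
        also have "\<dots> \<le> (\<integral>x. \<bar>indicator B x * (h (x, y) - h (z, y))\<bar> \<partial>M)"
          by simp
        also have "\<dots> \<le> (\<integral>x. indicator B x * (e * indicator L y) \<partial>M)"
        proof (rule integral_mono)
          show "integrable M (\<lambda>x. \<bar>indicator B x * (h (x, y) - h (z, y))\<bar>)"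
            using intAh[OF Bs(1)] indB by (simp add: right_diff_distrib)
          show "integrable M (\<lambda>x. indicator B x * (e * indicator L y))"
            using indB by simp
          show "\<bar>indicator B x * (h (x, y) - h (z, y))\<bar> \<le> indicator B x * (e * indicator L y)" for x
            using cl[of x y] by (cases "x \<in> B") auto
        qed
        also have "\<dots> = (e * measure M B) * indicator L y"
          using Bs by simp
        finally show ?thesis .
      qed
    qed
    also have "\<dots> = e * measure N L * measure M B"
      using Ls by simp
    finally have 2: "\<bar>(\<integral>y. b B y \<partial>N) - measure M B * a z\<bar> \<le> e * measure N L * measure M B" .
    have "measure M A = measure M B + measure M C"
      using measure_Union[of M B C] fin Bs Cs by (auto simp: B_def C_def Int_Diff_Un less_top[symmetric])
    moreover have "(\<integral>x. indicator A x * a x \<partial>M) = (\<integral>x. indicator B x * a x \<partial>M) + (\<integral>x. indicator C x * a x \<partial>M)"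
      using intAa[OF Bs(1)] intAa[OF Cs(1)] by (simp add: ind distrib_right)
    moreover have "b A y = b B y + b C y" for y
      unfolding b_def using intAh[OF Bs(1)] intAh[OF Cs(1)] by (simp add: ind distrib_right)
    then have "(\<integral>y. b A y \<partial>N) = (\<integral>y. b B y \<partial>N) + (\<integral>y. b C y \<partial>N)"
      using intb[OF Bs(1)] intb[OF Cs(1)] by simp
    ultimately show ?case
      using 1 2 IC by (simp add: algebra_simps)
  qed
  have "\<bar>(\<integral>x. a x \<partial>M) - (\<integral>y. b K y \<partial>N)\<bar> \<le> 0 + e" if "e > 0" for e
  proof -
    \<comment> \<open>The summand 1 makes \<open>c\<close> positive even if \<open>K\<close> or
      \<open>L\<close> is null.\<close>
    define c where "c = 2 * measure N L * measure M K + 1"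
    have c: "c > 0" "2 * measure N L * measure M K \<le> c"
      by (auto simp: c_def add_nonneg_pos)
    have "\<exists>U. open U \<and> z \<in> U \<and> (\<forall>x\<in>U. \<forall>y\<in>L. \<bar>h (x, y) - h (z, y)\<bar> < e / c)" for z
      using tube_lemma_dist[OF h L, of "e / c" z] c that by simp
    then obtain U where U: "\<And>z. open (U z)" "\<And>z. z \<in> U z"
      "\<And>x y z. x \<in> U z \<Longrightarrow> y \<in> L \<Longrightarrow> \<bar>h (x, y) - h (z, y)\<bar> < e / c"
      by metis
    obtain F where F: "finite F" "K \<subseteq> (\<Union>z\<in>F. U z)"
    proof (rule compactE_image[OF K, of K U])
      show "K \<subseteq> (\<Union>z\<in>K. U z)"
        using U(2) by auto
    qed (use U(1) that in auto)
    have "\<bar>(\<integral>x. indicator K x * a x \<partial>M) - (\<integral>y. b K y \<partial>N)\<bar> \<le> 2 * (e / c) * measure N L * measure M K"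
      using F U Ks c that by (intro bound[where F = F and U = U]) auto
    also have "\<dots> = (e / c) * (2 * measure N L * measure M K)"
      by simp
    also have "\<dots> \<le> (e / c) * c"
      using c that by (intro mult_left_mono) auto
    also have "\<dots> = e"
      using c by simp
    also have "(\<lambda>x. indicator K x * a x) = a"
      using a0 by (fastforce simp: indicator_def)
    finally show ?thesis by simp
  qed
  then have "\<bar>(\<integral>x. a x \<partial>M) - (\<integral>y. b K y \<partial>N)\<bar> \<le> 0"
    by (rule field_le_epsilon)
  moreover have "indicator K x * h (x, y) = h (x, y)" for x y
    using supp[of x y] by (auto simp: indicator_def)
  ultimately show ?thesis
    by (simp add: a_def b_def)
qed

section \<open>Haar measure and the modular function\<close>

locale haar_measure =
  fixes \<mu> :: "'a::{t2_space, group_add} measure"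
  assumes locally_compact_group: "locally_compact_group TYPE('a)"
    and left_haar: "left_haar_measure \<mu>"
begin

lemma sets_haar [simp, measurable_cong]: "sets \<mu> = sets borel"
  using left_haar by (simp add: left_haar_measure_def)

lemma space_haar [simp]: "space \<mu> = UNIV"
  using sets_eq_imp_space_eq[OF sets_haar] by simp

lemma borel_measurable_haar [simp]: "borel_measurable \<mu> = borel_measurable borel"
  by (rule measurable_cong_sets) simp_all

lemma finite_on_compact: "compact K \<Longrightarrow> emeasure \<mu> K < \<infinity>"
  using left_haar by (simp add: left_haar_measure_def)

lemma outer_regular:
  assumes "A \<in> sets borel"
  shows "emeasure \<mu> A = (INF U\<in>{U. open U \<and> A \<subseteq> U}. emeasure \<mu> U)"
  using left_haar assms unfolding left_haar_measure_def by (elim conjE, elim bspec)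

section \<open>Continuity, compactness and translation in the group\<close>

lemma continuous_on_group_add:
  fixes f g :: "'b::topological_space \<Rightarrow> 'a"
  assumes "continuous_on S f" "continuous_on S g"
  shows "continuous_on S (\<lambda>x. f x + g x)"
proof -
  have "continuous_on UNIV (\<lambda>p::'a \<times> 'a. fst p + snd p)"
    using locally_compact_group by (simp add: locally_compact_group_def)
  from continuous_on_compose2[OF this continuous_on_Pair[OF assms]] show ?thesis
    by simp
qed

lemma continuous_on_group_minus:
  fixes f :: "'b::topological_space \<Rightarrow> 'a"
  assumes "continuous_on S f"
  shows "continuous_on S (\<lambda>x. - f x)"
proof -
  have "continuous_on UNIV (\<lambda>x::'a. - x)"
    using locally_compact_group by (simp add: locally_compact_group_def)
  from continuous_on_compose2[OF this assms] show ?thesis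
    by simp
qed

lemma continuous_on_group_diff:
  fixes f g :: "'b::topological_space \<Rightarrow> 'a"
  assumes "continuous_on S f" "continuous_on S g"
  shows "continuous_on S (\<lambda>x. f x - g x)"
  using continuous_on_group_add[OF assms(1) continuous_on_group_minus[OF assms(2)]] by simp

lemmas group_continuous_intros =
  continuous_on_group_add continuous_on_group_minus continuous_on_group_diff continuous_intros

lemma measurable_group_minus [measurable]: "uminus \<in> borel_measurable (borel :: 'a measure)"
  by (intro borel_measurable_continuous_onI group_continuous_intros)

lemma measurable_group_translation [measurable]: "(\<lambda>x. c + x) \<in> borel_measurable (borel :: 'a measure)"
  by (intro borel_measurable_continuous_onI group_continuous_intros)

lemma compact_group_minus: "compact K \<Longrightarrow> compact (uminus ` K :: 'a set)"
  by (intro compact_continuous_image group_continuous_intros)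

lemma compact_group_diff:
  assumes "compact K" "compact L"
  shows "compact ((\<lambda>p. fst p - snd p :: 'a) ` (K \<times> L))"
  by (intro compact_continuous_image group_continuous_intros compact_Times assms)

lemma open_vimage_group_minus: "open U \<Longrightarrow> open (uminus -` U :: 'a set)"
  by (intro open_vimage group_continuous_intros)

lemma distr_translation: "distr \<mu> \<mu> (\<lambda>x. c + x) = \<mu>"
proof (rule measure_eqI)
  fix A assume "A \<in> sets (distr \<mu> \<mu> (\<lambda>x. c + x))"
  then have A: "A \<in> sets borel" by simp
  have "(\<lambda>x. c + x) -` A = (\<lambda>y. - c + y) ` A"
  proof (intro equalityI subsetI)
    fix x assume "x \<in> (\<lambda>x. c + x) -` A"
    then show "x \<in> (\<lambda>y. - c + y) ` A"
      by (intro image_eqI[of _ _ "c + x"]) (auto simp: add.assoc[symmetric])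
  qed (auto simp: add.assoc[symmetric])
  then show "emeasure (distr \<mu> \<mu> (\<lambda>x. c + x)) A = emeasure \<mu> A"
    using A left_haar by (simp add: emeasure_distr left_haar_measure_def)
qed simp

lemma integral_translation:
  fixes f :: "'a \<Rightarrow> 'b::{banach, second_countable_topology}"
  assumes "f \<in> borel_measurable borel"
  shows "(\<integral>x. f (c + x) \<partial>\<mu>) = (\<integral>x. f x \<partial>\<mu>)"
  using integral_distr[of "\<lambda>x. c + x" \<mu> \<mu> f] assms by (simp add: distr_translation)

text \<open>A locally compact Hausdorff space is completely regular, and \<open>K\<close> has an
  open neighbourhood \<open>U\<close> inside a compact set \<open>L\<close>.\<close>

lemma Urysohn_compact_open:
  fixes K V :: "'a set"
  assumes K: "compact K" and V: "open V" "K \<subseteq> V"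
  shows "\<exists>(f :: 'a \<Rightarrow> real) L. continuous_on UNIV f \<and> compact L \<and> (\<forall>x. x \<notin> L \<longrightarrow> f x = 0) \<and>
    (\<forall>x. 0 \<le> f x \<and> f x \<le> 1) \<and> (\<forall>x\<in>K. f x = 1) \<and> (\<forall>x. x \<notin> V \<longrightarrow> f x = 0)"
proof -
  let ?X = "euclidean :: 'a topology"
  have H: "Hausdorff_space ?X"
    unfolding Hausdorff_space_def disjnt_def using hausdorff by fastforce
  have lc: "locally_compact_space ?X"
    using locally_compact_group by (simp add: locally_compact_space_def locally_compact_group_def)
  have "\<exists>U L. openin ?X U \<and> compactin ?X L \<and> closedin ?X L \<and> K \<subseteq> U \<and> U \<subseteq> L"
    using lc K locally_compact_space_compact_closed_compact[of ?X] H by simp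
  then obtain U L where U: "open U" "compact L" "K \<subseteq> U" "U \<subseteq> L"
    by auto
  have "completely_regular_space ?X"
    using lc H by (simp add: locally_compact_regular_imp_completely_regular_space)
  \<comment> \<open>Separating \<open>K\<close> from the complement of \<open>U \<inter> V\<close>
    yields compact support and vanishing off \<open>V\<close> at once.\<close>
  moreover have "closedin ?X (- (U \<inter> V))"
    using U V by (auto intro!: closed_Un closed_Compl)
  moreover have "disjnt K (- (U \<inter> V))"
    using U V by (auto simp: disjnt_def)
  ultimately obtain f where f: "continuous_map ?X (top_of_set {0..1::real}) f"
    "f ` (- (U \<inter> V)) \<subseteq> {0}" "f ` K \<subseteq> {1}"
    using K Urysohn_completely_regular_compact_closed[of 0 1 ?X K "- (U \<inter> V)"] by auto
  have c: "continuous_on UNIV f" and r: "f x \<in> {0..1}" for x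
    using f(1) by (auto simp: continuous_map_in_subtopology)
  have "f x = 0" if "x \<notin> L \<or> x \<notin> V" for x
    using f(2) U that by auto
  moreover have "f x = 1" if "x \<in> K" for x
    using f(3) that by auto
  ultimately show ?thesis
    using c r U(2) by (intro exI[of _ f] exI[of _ L]) auto
qed

lemma integrable_compact_support:
  fixes f :: "'a \<Rightarrow> real"
  assumes "continuous_on UNIV f" "compact K" "\<And>x. x \<notin> K \<Longrightarrow> f x = 0"
  shows "integrable \<mu> f"
  using assms by (intro integrable_continuous_compact_support[OF sets_haar finite_on_compact]) auto

text \<open>Were the integral zero, the nonempty open set where \<open>f\<close> is positive would
  be null, against the positivity of Haar measure on open sets.\<close>

lemma integral_pos:
  fixes f :: "'a \<Rightarrow> real"
  assumes f: "continuous_on UNIV f" and K: "compact K" "\<And>x. x \<notin> K \<Longrightarrow> f x = 0"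
    and nn: "\<And>x. 0 \<le> f x" and pos: "f x0 > 0"
  shows "(\<integral>x. f x \<partial>\<mu>) > 0"
proof -
  have int: "integrable \<mu> f"
    using f K by (rule integrable_compact_support)
  have "(\<integral>x. f x \<partial>\<mu>) \<noteq> 0"
  proof
    assume "(\<integral>x. f x \<partial>\<mu>) = 0"
    then have "AE x in \<mu>. f x = 0"
      using integral_nonneg_eq_0_iff_AE[OF int] nn by simp
    then have "AE x in \<mu>. x \<notin> {x. f x > 0}"
      by (rule AE_mp) auto
    moreover have op: "open {x. f x > 0}"
      using f by (intro open_Collect_less continuous_intros)
    ultimately have "emeasure \<mu> {x. f x > 0} = 0"
      using AE_iff_measurable[of "{x. f x > 0}" \<mu> "\<lambda>x. x \<notin> {x. f x > 0}"] by simp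
    moreover have "emeasure \<mu> {x. f x > 0} > 0"
      using left_haar op pos unfolding left_haar_measure_def by blast
    ultimately show False by simp
  qed
  moreover have "(\<integral>x. f x \<partial>\<mu>) \<ge> 0"
    using nn by simp
  ultimately show ?thesis by simp
qed

section \<open>Right translates and the density of the reflected measure\<close>

text \<open>For \<open>x\<close> in a compact neighbourhood \<open>N\<close> of \<open>x0\<close>,
  the function \<open>\<lambda>y. g (y + x)\<close> is supported in the compact set of differences
  of \<open>K\<close> and \<open>N\<close>.\<close>

lemma integral_right_translation_continuous:
  fixes g :: "'a \<Rightarrow> real"
  assumes g: "continuous_on UNIV g" and K: "compact K" "\<And>x. x \<notin> K \<Longrightarrow> g x = 0"
  shows "continuous_on UNIV (\<lambda>x. \<integral>y. g (y + x) \<partial>\<mu>)"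
proof -
  have "continuous_on UNIV (\<lambda>x. \<integral>y. indicator UNIV y * (\<lambda>p. g (snd p + fst p)) (x, y) \<partial>\<mu>)"
  proof (rule continuous_on_parametric_integral[OF sets_haar finite_on_compact])
    show "continuous_on UNIV (\<lambda>p. g (snd p + fst p))"
      by (intro continuous_on_compose2[OF g] group_continuous_intros) auto
    show "\<exists>U L. open U \<and> x0 \<in> U \<and> compact L \<and> (\<forall>x\<in>U. \<forall>y. y \<notin> L \<longrightarrow> g (snd (x, y) + fst (x, y)) = 0)" for x0
    proof -
      obtain U N where U: "open U" "compact N" "x0 \<in> U" "U \<subseteq> N"
        using locally_compact_group unfolding locally_compact_group_def by blast
      let ?L = "(\<lambda>p. fst p - snd p) ` (K \<times> N)"
      have "g (y + x) = 0" if "x \<in> U" "y \<notin> ?L" for x y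
      proof (rule K(2), rule notI)
        assume "y + x \<in> K"
        then have "y \<in> ?L"
          using that U by (intro image_eqI[of _ _ "(y + x, x)"]) (auto simp: add.assoc)
        then show False using that by simp
      qed
      then show ?thesis
        using U compact_group_diff[OF K(1) U(2)] by (intro exI[of _ U] exI[of _ ?L]) auto
    qed
  qed auto
  then show ?thesis by simp
qed

lemma integral_mult_right_translation:
  fixes f g :: "'a \<Rightarrow> real"
  assumes f: "continuous_on UNIV f" and K: "compact K" "\<And>x. x \<notin> K \<Longrightarrow> f x = 0"
    and g: "continuous_on UNIV g" and L: "compact L" "\<And>x. x \<notin> L \<Longrightarrow> g x = 0"
  shows "(\<integral>x. f x * (\<integral>y. g (y + x) \<partial>\<mu>) \<partial>\<mu>) = (\<integral>x. g x \<partial>\<mu>) * (\<integral>x. f (- x) \<partial>\<mu>)"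
proof -
  note Fubini = Fubini_continuous_compact_support[OF sets_haar finite_on_compact sets_haar finite_on_compact]
  \<comment> \<open>Contains every relevant \<open>y\<close> in both exchanges:
    \<open>y + x \<in> L\<close> with \<open>x \<in> K\<close>, and later
    \<open>- y + x \<in> K\<close> with \<open>x \<in> L\<close>, both make \<open>y\<close> a
    difference of points of \<open>L\<close> and \<open>K\<close>.\<close>
  let ?D = "(\<lambda>p. fst p - snd p) ` (L \<times> K)"
  have D: "compact ?D"
    using compact_group_diff[OF L(1) K(1)] .
  have [measurable]: "f \<in> borel_measurable borel" "g \<in> borel_measurable borel"
    using f g by (auto intro: borel_measurable_continuous_onI)
  have "(\<integral>x. f x * (\<integral>y. g (y + x) \<partial>\<mu>) \<partial>\<mu>) = (\<integral>x. \<integral>y. (\<lambda>p. f (fst p) * g (snd p + fst p)) (x, y) \<partial>\<mu> \<partial>\<mu>)"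
    by simp
  also have "\<dots> = (\<integral>y. \<integral>x. (\<lambda>p. f (fst p) * g (snd p + fst p)) (x, y) \<partial>\<mu> \<partial>\<mu>)"
  proof (rule Fubini[OF _ _ _ K(1) D])
    show "continuous_on UNIV (\<lambda>p. f (fst p) * g (snd p + fst p))"
      by (intro continuous_on_mult continuous_on_compose2[OF f] continuous_on_compose2[OF g]
          group_continuous_intros) auto
    show "f (fst (x, y)) * g (snd (x, y) + fst (x, y)) = 0" if "x \<notin> K \<or> y \<notin> ?D" for x y
    proof (cases "x \<in> K \<and> y + x \<in> L")
      case True
      then have "y \<in> ?D"
        by (intro image_eqI[of _ _ "(y + x, x)"]) (auto simp: add.assoc)
      then show ?thesis using that True by simp
    qed (use K L in auto)
  qed
  \<comment> \<open>Left translation of \<open>x\<close> by \<open>- y\<close> for fixed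
    \<open>y\<close> moves the dependence on \<open>y\<close> from \<open>g\<close> to
    \<open>f\<close>.\<close>
  also have "\<dots> = (\<integral>y. \<integral>x. f (- y + x) * g x \<partial>\<mu> \<partial>\<mu>)"
  proof (rule Bochner_Integration.integral_cong[OF refl])
    fix y
    have "(\<lambda>x. f (- y + x) * g x) \<in> borel_measurable borel"
      by measurable
    from integral_translation[OF this, of y]
    show "(\<integral>x. (\<lambda>p. f (fst p) * g (snd p + fst p)) (x, y) \<partial>\<mu>) = (\<integral>x. f (- y + x) * g x \<partial>\<mu>)"
      by (simp add: add.assoc[symmetric])
  qed
  also have "\<dots> = (\<integral>y. \<integral>x. (\<lambda>p. f (- snd p + fst p) * g (fst p)) (x, y) \<partial>\<mu> \<partial>\<mu>)"
    by simp
  also have "\<dots> = (\<integral>x. \<integral>y. (\<lambda>p. f (- snd p + fst p) * g (fst p)) (x, y) \<partial>\<mu> \<partial>\<mu>)"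
  proof (rule Fubini[OF _ _ _ L(1) D, symmetric])
    show "continuous_on UNIV (\<lambda>p. f (- snd p + fst p) * g (fst p))"
      by (intro continuous_on_mult continuous_on_compose2[OF f] continuous_on_compose2[OF g]
          group_continuous_intros) auto
    show "f (- snd (x, y) + fst (x, y)) * g (fst (x, y)) = 0" if "x \<notin> L \<or> y \<notin> ?D" for x y
    proof (cases "x \<in> L \<and> - y + x \<in> K")
      case True
      then have "y \<in> ?D"
        by (intro image_eqI[of _ _ "(x, - y + x)"]) (auto simp: diff_conv_add_uminus minus_add add.assoc[symmetric] simp del: add_uminus_conv_diff)
      then show ?thesis using that True by simp
    qed (use K L in auto)
  qed
  \<comment> \<open>Left translation of \<open>y\<close> by \<open>x\<close> for fixed
    \<open>x\<close>: \<open>- (x + y) + x = - y\<close>, also without commutativity.\<close>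
  also have "\<dots> = (\<integral>x. g x * (\<integral>y. f (- y) \<partial>\<mu>) \<partial>\<mu>)"
  proof (rule Bochner_Integration.integral_cong[OF refl])
    fix x
    have "(\<lambda>y. f (- y + x)) \<in> borel_measurable borel"
      by (intro borel_measurable_continuous_onI continuous_on_compose2[OF f] group_continuous_intros) auto
    from integral_translation[OF this, of x]
    have "(\<integral>y. f (- y + x) \<partial>\<mu>) = (\<integral>y. f (- y) \<partial>\<mu>)"
      by (simp add: minus_add add.assoc diff_conv_add_uminus del: add_uminus_conv_diff)
    then show "(\<integral>y. (\<lambda>p. f (- snd p + fst p) * g (fst p)) (x, y) \<partial>\<mu>) = g x * (\<integral>y. f (- y) \<partial>\<mu>)"
      by (simp add: mult.commute)
  qed
  also have "\<dots> = (\<integral>x. g x \<partial>\<mu>) * (\<integral>x. f (- x) \<partial>\<mu>)"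
    by simp
  finally show ?thesis .
qed

text \<open>A bump at \<open>x\<close> supported where \<open>d2 < d1\<close> would have positive
  integral against \<open>d1 - d2\<close>. Used in both directions, this is uniqueness of continuous
  densities.\<close>

lemma continuous_density_le:
  fixes d1 d2 :: "'a \<Rightarrow> real"
  assumes d: "continuous_on UNIV d1" "continuous_on UNIV d2"
    and eq: "\<And>f K. continuous_on UNIV f \<Longrightarrow> compact K \<Longrightarrow> (\<And>x. x \<notin> K \<Longrightarrow> f x = 0) \<Longrightarrow>
      (\<integral>x. f x * d1 x \<partial>\<mu>) = (\<integral>x. f x * d2 x \<partial>\<mu>)"
  shows "d1 x \<le> d2 x"
proof (rule ccontr)
  assume "\<not> d1 x \<le> d2 x"
  then have sub: "{x} \<subseteq> {x. d2 x < d1 x}"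
    by simp
  have "open {x. d2 x < d1 x}"
    using d by (intro open_Collect_less)
  from Urysohn_compact_open[OF compact_sing this sub] obtain f :: "'a \<Rightarrow> real" and L where f: "continuous_on UNIV f" "compact L" "\<And>x. x \<notin> L \<Longrightarrow> f x = 0"
    "\<And>x. 0 \<le> f x" "f x = 1" "\<And>x. \<not> d2 x < d1 x \<Longrightarrow> f x = 0"
    by auto
  have int: "integrable \<mu> (\<lambda>x. f x * d1 x)" "integrable \<mu> (\<lambda>x. f x * d2 x)"
    using f d by (auto intro!: integrable_compact_support[where K = L] continuous_intros)
  have "(\<integral>x. f x * (d1 x - d2 x) \<partial>\<mu>) > 0"
  proof (rule integral_pos[where K = L and ?x0.0 = x])
    show "0 \<le> f x * (d1 x - d2 x)" for x
      using f(4,6)[of x] by (cases "d2 x < d1 x") auto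
  qed (use f d \<open>\<not> d1 x \<le> d2 x\<close> in \<open>auto intro!: continuous_intros\<close>)
  moreover have "(\<integral>x. f x * (d1 x - d2 x) \<partial>\<mu>) = 0"
    using eq[OF f(1-3)] int by (simp add: right_diff_distrib)
  ultimately show False by simp
qed

end

text \<open>In the usual notation \<open>d x\<close> is \<open>\<Delta>(x\<inverse>)\<close>, where \<open>\<Delta>\<close> is the modular function.\<close>
locale haar_measure_modular = haar_measure \<mu> for \<mu> :: "'a::{t2_space, group_add} measure" +
  fixes d :: "'a \<Rightarrow> real"
  assumes d_cont: "continuous_on UNIV d"
    and d_pos: "\<And>x. d x > 0"
    and d_add: "\<And>x y. d (x + y) = d x * d y"
    and d_inv: "\<And>f K. continuous_on UNIV f \<Longrightarrow> compact K \<Longrightarrow> (\<And>x. x \<notin> K \<Longrightarrow> f x = 0) \<Longrightarrow>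
      (\<integral>x. f x * d x \<partial>\<mu>) = (\<integral>x. f (- x) \<partial>\<mu>)"

lemma (in haar_measure) modular_function_exists: "\<exists>d. haar_measure_modular \<mu> d"
proof -
  obtain g :: "'a \<Rightarrow> real" and L where g: "continuous_on UNIV g" "compact L" "\<And>x. x \<notin> L \<Longrightarrow> g x = 0"
    "\<And>x. 0 \<le> g x" "g 0 = 1"
    using Urysohn_compact_open[of "{0}" UNIV] by auto
  define G where "G x = (\<integral>y. g (y + x) \<partial>\<mu>)" for x
  have gz: "continuous_on UNIV (\<lambda>y. g (y + z))" for z
    by (intro continuous_on_compose2[OF g(1)] group_continuous_intros) auto
  have Lz: "compact ((\<lambda>p. fst p - snd p) ` (L \<times> {z}))" for z
    by (intro compact_group_diff g) auto
  have supp: "g (y + z) = 0" if "y \<notin> (\<lambda>p. fst p - snd p) ` (L \<times> {z})" for y z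
  proof (rule g(3), rule notI)
    assume "y + z \<in> L"
    then have "y \<in> (\<lambda>p. fst p - snd p) ` (L \<times> {z})"
      by (intro image_eqI[of _ _ "(y + z, z)"]) (auto simp: add.assoc)
    then show False using that by simp
  qed
  \<comment> \<open>The translate of \<open>g\<close> takes the value \<open>g 0 = 1\<close> at
    \<open>- z\<close>.\<close>
  have Gpos: "G z > 0" for z
    unfolding G_def
    by (rule integral_pos[OF gz Lz supp, where ?x0.0 = "- z"]) (use g in auto)
  have cG: "continuous_on UNIV G"
    unfolding G_def using g by (intro integral_right_translation_continuous)
  have G0: "(\<integral>y. g y \<partial>\<mu>) = G 0"
    by (simp add: G_def)
  \<comment> \<open>The exchange formula for the right translate of \<open>g\<close> by
    \<open>z\<close>, whose total integral is \<open>G z\<close>.\<close>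
  have inv: "(\<integral>x. f x * (G (x + z) / G z) \<partial>\<mu>) = (\<integral>x. f (- x) \<partial>\<mu>)"
    if f: "continuous_on UNIV f" "compact K" "\<And>x. x \<notin> K \<Longrightarrow> f x = 0" for f :: "'a \<Rightarrow> real" and K z
  proof -
    have "(\<integral>x. f x * G (x + z) \<partial>\<mu>) = G z * (\<integral>x. f (- x) \<partial>\<mu>)"
      using integral_mult_right_translation[OF f gz Lz supp, of z] by (simp add: G_def add.assoc)
    then show ?thesis
      using Gpos[of z] by (simp add: field_simps)
  qed
  have cont: "continuous_on UNIV (\<lambda>x. G (x + z) / G z)" for z
    using Gpos[of z] by (intro continuous_intros continuous_on_compose2[OF cG] group_continuous_intros) auto
  \<comment> \<open>\<open>\<lambda>x. G (x + z)\<close> belongs to the right translate of \<open>g\<close> by \<open>z\<close>, so both sides are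
    continuous densities of the reflected measure.\<close>
  have eq: "G (x + z) / G z = G x / G 0" for x z
  proof (rule antisym)
    show "G (x + z) / G z \<le> G x / G 0"
      using inv[where z = z] inv[where z = 0] cont[of z] cont[of 0] by (intro continuous_density_le[where x = x]) auto
    show "G x / G 0 \<le> G (x + z) / G z"
      using inv[where z = z] inv[where z = 0] cont[of z] cont[of 0] by (intro continuous_density_le[where x = x]) auto
  qed
  have "haar_measure_modular \<mu> (\<lambda>x. G x / G 0)"
  proof
    show "continuous_on UNIV (\<lambda>x. G x / G 0)"
      using cont[of 0] by simp
    show "G (x + y) / G 0 = G x / G 0 * (G y / G 0)" for x y
      using eq[of x y] Gpos[of y] Gpos[of 0] by (simp add: field_simps)
    show "(\<integral>x. f x * (G x / G 0) \<partial>\<mu>) = (\<integral>x. f (- x) \<partial>\<mu>)"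
      if "continuous_on UNIV f" "compact K" "\<And>x. x \<notin> K \<Longrightarrow> f x = 0" for f K
      using inv[OF that, where z = 0] by simp
  qed (use Gpos in auto)
  then show ?thesis by blast
qed

section \<open>Reflection\<close>

context haar_measure_modular
begin

lemma measurable_modular [measurable]: "d \<in> borel_measurable borel"
  using d_cont by (rule borel_measurable_continuous_onI)

section \<open>Domination of the reflected measure\<close>

text \<open>A Urysohn function between the indicators of \<open>K\<close> and \<open>V\<close>
  carries \<open>d_inv\<close> from continuous functions over to sets.\<close>

lemma nn_integral_density_compact_le:
  assumes K: "compact K" and V: "open V" "K \<subseteq> V"
  shows "(\<integral>\<^sup>+x. ennreal (d x) * indicator K x \<partial>\<mu>) \<le> emeasure \<mu> (uminus -` V)"
proof -
  obtain f :: "'a \<Rightarrow> real" and L where f: "continuous_on UNIV f" "compact L" "\<And>x. x \<notin> L \<Longrightarrow> f x = 0"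
    "\<And>x. 0 \<le> f x" "\<And>x. f x \<le> 1" "\<And>x. x \<in> K \<Longrightarrow> f x = 1" "\<And>x. x \<notin> V \<Longrightarrow> f x = 0"
    using Urysohn_compact_open[OF K V] by auto
  have int1: "integrable \<mu> (\<lambda>x. f x * d x)"
    using f d_cont by (auto intro!: integrable_compact_support[where K = L] continuous_intros)
  have int2: "integrable \<mu> (\<lambda>x. f (- x))"
  proof (rule integrable_compact_support[OF _ compact_group_minus[OF f(2)]])
    show "continuous_on UNIV (\<lambda>x. f (- x))"
      by (intro continuous_on_compose2[OF f(1)] group_continuous_intros) auto
    show "f (- x) = 0" if "x \<notin> uminus ` L" for x
      using that by (intro f(3)) (metis image_eqI minus_minus)
  qed
  have Vs: "uminus -` V \<in> sets \<mu>"
    using open_vimage_group_minus[OF V(1)] by simp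
  have "(\<integral>\<^sup>+x. ennreal (d x) * indicator K x \<partial>\<mu>) \<le> (\<integral>\<^sup>+x. ennreal (f x * d x) \<partial>\<mu>)"
    using f(6) by (intro nn_integral_mono) (auto simp: indicator_def)
  also have "\<dots> = ennreal (\<integral>x. f x * d x \<partial>\<mu>)"
    using f(4) d_pos by (intro nn_integral_eq_integral int1) (auto simp: less_imp_le)
  also have "\<dots> = ennreal (\<integral>x. f (- x) \<partial>\<mu>)"
    using d_inv[OF f(1-3)] by simp
  also have "\<dots> = (\<integral>\<^sup>+x. ennreal (f (- x)) \<partial>\<mu>)"
    using f(4) by (intro nn_integral_eq_integral[symmetric] int2) auto
  also have "\<dots> \<le> (\<integral>\<^sup>+x. indicator (uminus -` V) x \<partial>\<mu>)"
    using f(5,7) by (intro nn_integral_mono) (auto simp: indicator_def)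
  also have "\<dots> = emeasure \<mu> (uminus -` V)"
    using Vs by simp
  finally show ?thesis .
qed

text \<open>Where \<open>d\<close> varies by a bounded factor, inner regularity of \<open>\<mu>\<close> on open sets passes to
  \<open>density \<mu> d\<close> up to a constant, which avoids proving that \<open>density \<mu> d\<close> is itself regular.\<close>
lemma emeasure_density_slice_le:
  assumes A: "A \<in> sets borel" and a: "a > 0" and slice: "\<And>x. x \<in> A \<Longrightarrow> a \<le> d x \<and> d x < 2 * a"
  shows "emeasure (density \<mu> d) A \<le> 4 * emeasure \<mu> (uminus -` A)"
proof -
  have B: "uminus -` A \<in> sets borel"
    using measurable_sets_borel[OF measurable_group_minus A] .
  \<comment> \<open>Dividing by 4 leaves \<open>emeasure \<mu> U\<close> alone on the right, ready
    for the infimum of outer regularity.\<close>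
  have "emeasure (density \<mu> d) A / 4 \<le> emeasure \<mu> U" if U: "open U" "uminus -` A \<subseteq> U" for U
  proof -
    \<comment> \<open>An open neighbourhood of \<open>A\<close> whose reflection lies in
      \<open>U\<close>. The lower bound is relaxed to \<open>a / 2\<close> because
      \<open>a \<le> d x\<close> is not an open condition; the constant 4 is the ratio of
      \<open>2 * a\<close> to \<open>a / 2\<close>.\<close>
    define V where "V = uminus -` U \<inter> {x. a / 2 < d x} \<inter> {x. d x < 2 * a}"
    have V: "open V"
      unfolding V_def using U(1)
      by (intro open_Int open_vimage_group_minus open_Collect_less d_cont continuous_on_const)
    have Vs [measurable]: "V \<in> sets borel"
      using V by simp
    have AV: "A \<subseteq> V"
    proof
      fix x assume "x \<in> A"
      then show "x \<in> V"
        using slice[of x] a subsetD[OF U(2), of "- x"] by (auto simp: V_def)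
    qed
    have VU: "uminus -` V \<subseteq> U"
      by (auto simp: V_def)
    have K: "ennreal (2 * a) * emeasure \<mu> K \<le> 4 * emeasure \<mu> U" if K: "compact K" "K \<subseteq> V" for K
    proof -
      have Ks [measurable]: "K \<in> sets borel"
        using K by (simp add: borel_closed compact_imp_closed)
      have "ennreal (2 * a) * emeasure \<mu> K = (\<integral>\<^sup>+x. ennreal (2 * a) * indicator K x \<partial>\<mu>)"
        using Ks by (simp add: nn_integral_cmult_indicator)
      also have "\<dots> \<le> (\<integral>\<^sup>+x. 4 * (ennreal (d x) * indicator K x) \<partial>\<mu>)"
      proof (rule nn_integral_mono)
        fix x
        show "ennreal (2 * a) * indicator K x \<le> 4 * (ennreal (d x) * indicator K x)"
        proof (cases "x \<in> K")
          case True
          then have "2 * a \<le> 4 * d x"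
            using K by (auto simp: V_def)
          then have "ennreal (2 * a) \<le> ennreal (4 * d x)"
            by (rule ennreal_leI)
          then show ?thesis
            using True d_pos[of x] by (simp add: ennreal_mult)
        qed simp
      qed
      also have "\<dots> = 4 * (\<integral>\<^sup>+x. ennreal (d x) * indicator K x \<partial>\<mu>)"
        by (intro nn_integral_cmult) simp
      also have "\<dots> \<le> 4 * emeasure \<mu> (uminus -` V)"
        by (intro mult_left_mono nn_integral_density_compact_le K V) auto
      also have "\<dots> \<le> 4 * emeasure \<mu> U"
        using U VU by (intro mult_left_mono emeasure_mono) auto
      finally show ?thesis .
    qed
    have "emeasure (density \<mu> d) A = (\<integral>\<^sup>+x. ennreal (d x) * indicator A x \<partial>\<mu>)"
      using A by (simp add: emeasure_density)
    also have "\<dots> \<le> (\<integral>\<^sup>+x. ennreal (2 * a) * indicator V x \<partial>\<mu>)"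
      using AV slice by (intro nn_integral_mono) (force simp: indicator_def intro!: ennreal_leI)
    also have "\<dots> = ennreal (2 * a) * emeasure \<mu> V"
      by (simp add: nn_integral_cmult_indicator)
    also have "emeasure \<mu> V = (SUP K\<in>{K. compact K \<and> K \<subseteq> V}. emeasure \<mu> K)"
      using left_haar V unfolding left_haar_measure_def by blast
    also have "ennreal (2 * a) * \<dots> = (SUP K\<in>{K. compact K \<and> K \<subseteq> V}. ennreal (2 * a) * emeasure \<mu> K)"
      by (intro SUP_mult_left_ennreal)
    also have "\<dots> \<le> 4 * emeasure \<mu> U"
      using K by (intro SUP_least) auto
    finally show ?thesis
      by (simp add: divide_le_posI_ennreal)
  qed
  then have "emeasure (density \<mu> d) A / 4 \<le> (INF U\<in>{U. open U \<and> uminus -` A \<subseteq> U}. emeasure \<mu> U)"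
    by (intro INF_greatest) auto
  also have "\<dots> = emeasure \<mu> (uminus -` A)"
    using outer_regular[OF B] by (rule sym)
  finally have "4 * (emeasure (density \<mu> d) A / 4) \<le> 4 * emeasure \<mu> (uminus -` A)"
    by (intro mult_left_mono) auto
  also have "4 * (emeasure (density \<mu> d) A / 4) = emeasure (density \<mu> d) A"
    by (simp add: ennreal_times_divide ennreal_mult_divide_eq mult.commute[of 4])
  finally show ?thesis .
qed

text \<open>As \<open>d\<close> is positive, \<open>A\<close> splits into countably many dyadic
  slices \<open>2 powr n \<le> d x < 2 powr (n + 1)\<close> with integer \<open>n\<close>. The
  constant 4 is the same on every slice and survives summation.\<close>

lemma emeasure_density_le:
  assumes A: "A \<in> sets borel"
  shows "emeasure (density \<mu> d) A \<le> 4 * emeasure \<mu> (uminus -` A)"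
proof -
  define S where "S n = A \<inter> {x. \<lfloor>log 2 (d x)\<rfloor> = n}" for n
  have Ss [measurable]: "S n \<in> sets borel" for n
    unfolding S_def using A by measurable
  have Sm: "uminus -` S n \<in> sets borel" for n
    using measurable_sets_borel[OF measurable_group_minus Ss] .
  have disj: "disjoint_family S"
    by (auto simp: S_def disjoint_family_on_def)
  have disj': "disjoint_family (\<lambda>n. uminus -` S n)"
    by (auto simp: S_def disjoint_family_on_def)
  have slice: "emeasure (density \<mu> d) (S n) \<le> 4 * emeasure \<mu> (uminus -` S n)" for n
  proof (rule emeasure_density_slice_le[OF Ss, of "2 powr n"])
    fix x assume "x \<in> S n"
    then have "real_of_int n \<le> log 2 (d x)" "log 2 (d x) < real_of_int n + 1"
      by (auto simp: S_def)
    then have "2 powr n \<le> d x" "d x < 2 powr (n + 1)"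
      using d_pos[of x] by (simp_all add: le_log_iff log_less_iff)
    then show "2 powr n \<le> d x \<and> d x < 2 * 2 powr n"
      by (simp add: powr_add mult.commute)
  qed simp
  have "emeasure (density \<mu> d) (\<Union>n. S n) = (\<integral>\<^sup>+n. emeasure (density \<mu> d) (S n) \<partial>count_space UNIV)"
    using disj by (intro emeasure_UN_countable) auto
  also have "\<dots> \<le> (\<integral>\<^sup>+n. 4 * emeasure \<mu> (uminus -` S n) \<partial>count_space UNIV)"
    using slice by (intro nn_integral_mono)
  also have "\<dots> = 4 * (\<integral>\<^sup>+n. emeasure \<mu> (uminus -` S n) \<partial>count_space UNIV)"
    by (intro nn_integral_cmult) auto
  also have "(\<integral>\<^sup>+n. emeasure \<mu> (uminus -` S n) \<partial>count_space UNIV) = emeasure \<mu> (\<Union>n. uminus -` S n)"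
    using disj' Sm by (intro emeasure_UN_countable[symmetric]) auto
  also have "(\<Union>n. uminus -` S n) = uminus -` A"
    by (auto simp: S_def)
  also have "(\<Union>n. S n) = A"
    by (auto simp: S_def)
  finally show ?thesis .
qed

text \<open>On sets, the reflection of \<open>density \<mu> d\<close> is dominated by
  \<open>4\<close> times \<open>\<mu>\<close>, and the nonnegative integral is monotone in the
  measure.\<close>

lemma nn_integral_inversion_le:
  assumes F [measurable]: "F \<in> borel_measurable borel"
  shows "(\<integral>\<^sup>+x. ennreal (d x) * F (- x) \<partial>\<mu>) \<le> 4 * (\<integral>\<^sup>+x. F x \<partial>\<mu>)"
proof -
  let ?N = "distr (density \<mu> d) \<mu> uminus"
  have m [measurable]: "uminus \<in> measurable (density \<mu> d) \<mu>"
    by simp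
  have "?N \<le> scale_measure 4 \<mu>"
  proof (subst le_measure)
    show "\<forall>A\<in>sets ?N. emeasure ?N A \<le> emeasure (scale_measure 4 \<mu>) A"
    proof
      fix A assume "A \<in> sets ?N"
      then have A: "A \<in> sets borel" by simp
      have "emeasure ?N A = emeasure (density \<mu> d) (uminus -` A)"
        using A by (subst emeasure_distr[OF m]) auto
      also have "\<dots> \<le> 4 * emeasure \<mu> (uminus -` uminus -` A)"
        using measurable_sets_borel[OF measurable_group_minus A] by (rule emeasure_density_le)
      also have "uminus -` uminus -` A = A"
        by auto
      finally show "emeasure ?N A \<le> emeasure (scale_measure 4 \<mu>) A"
        by simp
    qed
  qed simp
  then have "nn_integral ?N F \<le> nn_integral (scale_measure 4 \<mu>) F"
    by (intro nn_integral_mono_measure) auto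
  also have "nn_integral ?N F = (\<integral>\<^sup>+x. ennreal (d x) * F (- x) \<partial>\<mu>)"
    by (simp add: nn_integral_distr nn_integral_density)
  also have "nn_integral (scale_measure 4 \<mu>) F = 4 * (\<integral>\<^sup>+x. F x \<partial>\<mu>)"
    by (intro nn_integral_scale_measure) simp
  finally show ?thesis .
qed

lemma integral_inversion_le:
  fixes F :: "'a \<Rightarrow> real"
  assumes F: "integrable \<mu> F" and nn: "\<And>x. 0 \<le> F x"
  shows "integrable \<mu> (\<lambda>x. d x * F (- x))"
    and "(\<integral>x. d x * F (- x) \<partial>\<mu>) \<le> 4 * (\<integral>x. F x \<partial>\<mu>)"
proof -
  have [measurable]: "F \<in> borel_measurable borel"
    using borel_measurable_integrable[OF F] by simp
  have nn': "0 \<le> d x * F (- x)" for x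
    using nn d_pos[of x] by simp
  have "(\<integral>\<^sup>+x. ennreal (d x * F (- x)) \<partial>\<mu>) = (\<integral>\<^sup>+x. ennreal (d x) * ennreal (F (- x)) \<partial>\<mu>)"
    using d_pos nn by (simp add: ennreal_mult less_imp_le)
  also have "\<dots> \<le> 4 * (\<integral>\<^sup>+x. ennreal (F x) \<partial>\<mu>)"
    by (rule nn_integral_inversion_le) simp
  also have "(\<integral>\<^sup>+x. ennreal (F x) \<partial>\<mu>) = ennreal (\<integral>x. F x \<partial>\<mu>)"
    using F nn by (intro nn_integral_eq_integral) auto
  also have "4 * \<dots> = ennreal (4 * (\<integral>x. F x \<partial>\<mu>))"
    using nn by (simp add: ennreal_mult)
  finally have le: "(\<integral>\<^sup>+x. ennreal (d x * F (- x)) \<partial>\<mu>) \<le> ennreal (4 * (\<integral>x. F x \<partial>\<mu>))" .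
  show int: "integrable \<mu> (\<lambda>x. d x * F (- x))"
  proof (rule integrableI_nonneg)
    show "(\<lambda>x. d x * F (- x)) \<in> borel_measurable \<mu>"
      by measurable
    show "(\<integral>\<^sup>+x. ennreal (d x * F (- x)) \<partial>\<mu>) < \<infinity>"
      using le by (rule order_le_less_trans) simp
  qed (use nn' in auto)
  have "ennreal (\<integral>x. d x * F (- x) \<partial>\<mu>) \<le> ennreal (4 * (\<integral>x. F x \<partial>\<mu>))"
    using le nn' by (subst (asm) nn_integral_eq_integral[OF int]) auto
  then show "(\<integral>x. d x * F (- x) \<partial>\<mu>) \<le> 4 * (\<integral>x. F x \<partial>\<mu>)"
    using nn by (subst (asm) ennreal_le_iff) auto
qed

section \<open>Transfer of derivations\<close>

text \<open>The form is symmetric under reflection of the weight, so a second application gives the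
  converse.\<close>

lemma weakly_amenable_reflect:
  assumes w: "\<And>x. 0 \<le> \<omega> x"
    and wa: "weakly_amenable_L1 \<mu> \<omega>"
  shows "weakly_amenable_L1 \<mu> (\<lambda>x. \<omega> (- x))"
proof -
  define \<omega>' where "\<omega>' = (\<lambda>x. \<omega> (- x))"
  \<comment> \<open>The map \<open>f \<mapsto> f~\<close>, as \<open>d x\<close> is the modular
    function at the inverse of \<open>x\<close>.\<close>
  define r where "r f x = f (- x) * complex_of_real (d x)" for f x
  have d0: "d 0 = 1"
    using d_add[of 0 0] d_pos[of 0] by simp
  have dm1: "d x * d (- x) = 1" for x
    using d_add[of x "- x"] d0 by simp
  have rr: "r (r f) = f" for f
    using dm1 by (simp add: r_def fun_eq_iff mult.assoc mult.commute flip: of_real_mult)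
  have r_add: "r (\<lambda>x. f x + g x) = (\<lambda>x. r f x + r g x)" for f g
    by (simp add: r_def fun_eq_iff distrib_right)
  have r_scale: "r (\<lambda>x. c * f x) = (\<lambda>x. c * r f x)" for c f
    by (simp add: r_def fun_eq_iff)
  have r_L1: "r f \<in> L1w \<mu> v \<and> L1norm \<mu> v (r f) \<le> 4 * L1norm \<mu> (\<lambda>x. v (- x)) f"
    if f: "f \<in> L1w \<mu> (\<lambda>x. v (- x))" and v: "\<And>x. 0 \<le> v x" for f v
  proof -
    have [measurable]: "f \<in> borel_measurable borel" and int: "integrable \<mu> (\<lambda>x. norm (f x) * v (- x))"
      using f by (auto simp: L1w_def)
    have eq: "norm (r f x) * v x = d x * (norm (f (- x)) * v x)" for x
      using d_pos[of x] by (simp add: r_def norm_mult)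
    have "r f \<in> borel_measurable \<mu>"
      unfolding r_def by measurable
    then show ?thesis
      using integral_inversion_le[OF int] v by (simp add: L1w_def L1norm_def eq)
  qed
  \<comment> \<open>This holds pointwise, so no integrability or measurability of the convolution is needed.\<close>
  have conv_r: "r (conv \<mu> f g) = conv \<mu> (r g) (r f)"
    if "f \<in> borel_measurable borel" "g \<in> borel_measurable borel" for f g
  proof
    fix x
    note [measurable] = that
    have "conv \<mu> (r g) (r f) x = (\<integral>y. g (- y) * d y * (f (- x + y) * d (- y + x)) \<partial>\<mu>)"
      by (simp add: conv_def r_def minus_add)
    also have "\<dots> = (\<integral>y. (f (- x + y) * g (- y)) * d x \<partial>\<mu>)"
    proof (rule Bochner_Integration.integral_cong[OF refl])
      fix y
      have "d x = d y * d (- y + x)"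
        using d_add[of y "- y + x"] by (simp add: add.assoc[symmetric])
      then show "g (- y) * d y * (f (- x + y) * d (- y + x)) = (f (- x + y) * g (- y)) * d x"
        by (simp only: of_real_mult mult_ac)
    qed
    also have "\<dots> = (\<integral>y. f (- x + y) * g (- y) \<partial>\<mu>) * d x"
      by simp
    also have "(\<integral>y. f (- x + y) * g (- y) \<partial>\<mu>) = (\<integral>y. f y * g (- y + - x) \<partial>\<mu>)"
      using integral_translation[of "\<lambda>y. f (- x + y) * g (- y)" x]
      by (simp add: add.assoc[symmetric] minus_add)
    finally show "r (conv \<mu> f g) x = conv \<mu> (r g) (r f) x"
      by (simp add: r_def conv_def)
  qed
  have L1m: "f \<in> borel_measurable borel" if "f \<in> L1w \<mu> v" for f v
    using that by (simp add: L1w_def)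
  have nnorm: "L1norm \<mu> v f \<ge> 0" if "\<And>x. 0 \<le> v x" for f v
    using that by (simp add: L1norm_def)
  have r1: "r f \<in> L1w \<mu> \<omega>" "L1norm \<mu> \<omega> (r f) \<le> 4 * L1norm \<mu> \<omega>' f" if "f \<in> L1w \<mu> \<omega>'" for f
    using r_L1[of f \<omega>] that w by (auto simp: \<omega>'_def)
  have w': "\<And>x. 0 \<le> \<omega>' x" "\<omega> = (\<lambda>x. \<omega>' (- x))"
    using w by (auto simp: \<omega>'_def)
  have r2: "r f \<in> L1w \<mu> \<omega>'" "L1norm \<mu> \<omega>' (r f) \<le> 4 * L1norm \<mu> \<omega> f" if "f \<in> L1w \<mu> \<omega>" for f
    using r_L1[of f \<omega>'] that w' by auto
  \<comment> \<open>Needed with \<open>c = 1\<close> for the functionals \<open>E f\<close> and with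
    \<open>c = - 1\<close> for the functional implementing \<open>D\<close>.\<close>
  have dual: "in_dual \<mu> u (\<lambda>f. c * \<phi> (r f))"
    if \<phi>: "in_dual \<mu> v \<phi>" and v: "\<And>x. 0 \<le> v x"
      and ru: "\<And>f. f \<in> L1w \<mu> u \<Longrightarrow> r f \<in> L1w \<mu> v \<and> L1norm \<mu> v (r f) \<le> 4 * L1norm \<mu> u f" for u v \<phi> c
  proof -
    obtain B where B: "\<And>f. f \<in> L1w \<mu> v \<Longrightarrow> norm (\<phi> f) \<le> B * L1norm \<mu> v f"
      using \<phi> unfolding in_dual_def by metis
    have "norm (c * \<phi> (r f)) \<le> (norm c * (\<bar>B\<bar> * 4)) * L1norm \<mu> u f" if f: "f \<in> L1w \<mu> u" for f
    proof -
      have "norm (\<phi> (r f)) \<le> B * L1norm \<mu> v (r f)"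
        using B ru f by blast
      also have "\<dots> \<le> \<bar>B\<bar> * L1norm \<mu> v (r f)"
        using nnorm[OF v] by (intro mult_right_mono) auto
      also have "\<dots> \<le> \<bar>B\<bar> * (4 * L1norm \<mu> u f)"
        using ru f by (intro mult_left_mono) auto
      finally show ?thesis
        by (simp add: norm_mult mult_left_mono mult.assoc)
    qed
    then show ?thesis
      using \<phi> ru unfolding in_dual_def by (auto simp: r_add r_scale distrib_left)
  qed
  show ?thesis
    unfolding weakly_amenable_L1_def \<omega>'_def[symmetric]
  proof (intro allI impI)
    fix D assume D: "bounded_derivation \<mu> \<omega>' D"
    define E where "E f h = D (r f) (r h)" for f h
    have D_dual: "\<forall>f\<in>L1w \<mu> \<omega>'. in_dual \<mu> \<omega>' (D f)"
      and D_add: "\<forall>f\<in>L1w \<mu> \<omega>'. \<forall>g\<in>L1w \<mu> \<omega>'. \<forall>h\<in>L1w \<mu> \<omega>'. D (\<lambda>x. f x + g x) h = D f h + D g h"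
      and D_scale: "\<forall>c. \<forall>f\<in>L1w \<mu> \<omega>'. \<forall>h\<in>L1w \<mu> \<omega>'. D (\<lambda>x. c * f x) h = c * D f h"
      and D_bound: "\<exists>C. \<forall>f\<in>L1w \<mu> \<omega>'. \<forall>h\<in>L1w \<mu> \<omega>'.
        norm (D f h) \<le> C * L1norm \<mu> \<omega>' f * L1norm \<mu> \<omega>' h"
      and D_conv: "\<forall>f\<in>L1w \<mu> \<omega>'. \<forall>g\<in>L1w \<mu> \<omega>'. \<forall>h\<in>L1w \<mu> \<omega>'.
        D (conv \<mu> f g) h = D g (conv \<mu> h f) + D f (conv \<mu> g h)"
      using D unfolding bounded_derivation_def by - (elim conjE, assumption)+
    obtain C where C: "\<And>f h. f \<in> L1w \<mu> \<omega>' \<Longrightarrow> h \<in> L1w \<mu> \<omega>' \<Longrightarrow>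
        norm (D f h) \<le> C * L1norm \<mu> \<omega>' f * L1norm \<mu> \<omega>' h"
      using D_bound by metis
    have "bounded_derivation \<mu> \<omega> E"
      unfolding bounded_derivation_def
    proof (intro conjI ballI allI)
      show "in_dual \<mu> \<omega> (E f)" if "f \<in> L1w \<mu> \<omega>" for f
        using dual[of \<omega>' "D (r f)" \<omega> 1] r2 that w' D_dual unfolding E_def by simp
      show "E (\<lambda>x. f x + g x) h = E f h + E g h"
        if "f \<in> L1w \<mu> \<omega>" "g \<in> L1w \<mu> \<omega>" "h \<in> L1w \<mu> \<omega>" for f g h
        using D_add r2 that unfolding E_def r_add by simp
      show "E (\<lambda>x. c * f x) h = c * E f h" if "f \<in> L1w \<mu> \<omega>" "h \<in> L1w \<mu> \<omega>" for c f h
        using D_scale r2 that unfolding E_def r_scale by simp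
      \<comment> \<open>Each of the two reflected arguments costs a factor 4; \<open>C\<close> is
        replaced by its absolute value since its sign is unknown.\<close>
      have "norm (E f h) \<le> (16 * \<bar>C\<bar>) * L1norm \<mu> \<omega> f * L1norm \<mu> \<omega> h"
        if "f \<in> L1w \<mu> \<omega>" "h \<in> L1w \<mu> \<omega>" for f h
      proof -
        have "norm (E f h) \<le> C * (L1norm \<mu> \<omega>' (r f) * L1norm \<mu> \<omega>' (r h))"
          unfolding E_def using C[of "r f" "r h"] r2 that by (simp add: mult.assoc)
        also have "\<dots> \<le> \<bar>C\<bar> * (L1norm \<mu> \<omega>' (r f) * L1norm \<mu> \<omega>' (r h))"
          using nnorm[of \<omega>'] w' by (intro mult_right_mono) auto
        also have "\<dots> \<le> \<bar>C\<bar> * ((4 * L1norm \<mu> \<omega> f) * (4 * L1norm \<mu> \<omega> h))"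
          using nnorm[of \<omega>'] nnorm[of \<omega>] w w' r2 that by (intro mult_left_mono mult_mono) auto
        finally show ?thesis
          by (simp add: mult_ac)
      qed
      then show "\<exists>C. \<forall>f\<in>L1w \<mu> \<omega>. \<forall>h\<in>L1w \<mu> \<omega>. norm (E f h) \<le> C * L1norm \<mu> \<omega> f * L1norm \<mu> \<omega> h"
        by blast
      \<comment> \<open>Since \<open>r\<close> reverses convolutions, the two terms of the product
        rule for \<open>D\<close> merely trade places.\<close>
      show "E (conv \<mu> f g) h = E g (conv \<mu> h f) + E f (conv \<mu> g h)"
        if fgh: "f \<in> L1w \<mu> \<omega>" "g \<in> L1w \<mu> \<omega>" "h \<in> L1w \<mu> \<omega>" for f g h
        using D_conv r2 fgh by (simp add: E_def conv_r L1m)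
    qed
    then obtain \<phi> where \<phi>: "in_dual \<mu> \<omega> \<phi>"
      and E: "\<And>f h. f \<in> L1w \<mu> \<omega> \<Longrightarrow> h \<in> L1w \<mu> \<omega> \<Longrightarrow> E f h = \<phi> (conv \<mu> h f) - \<phi> (conv \<mu> f h)"
      using wa unfolding weakly_amenable_L1_def inner_derivation_def by blast
    show "inner_derivation \<mu> \<omega>' D"
      unfolding inner_derivation_def
    \<comment> \<open>The reversal of products exchanges the two terms of the commutator, whence the
      sign.\<close>
    proof (intro exI[of _ "\<lambda>f. (- 1) * \<phi> (r f)"] conjI ballI)
      show "in_dual \<mu> \<omega>' (\<lambda>f. (- 1) * \<phi> (r f))"
        using dual[OF \<phi>, of \<omega>' "- 1"] w r1 by blast
      fix f h assume fh: "f \<in> L1w \<mu> \<omega>'" "h \<in> L1w \<mu> \<omega>'"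
      have "D f h = E (r f) (r h)"
        by (simp add: E_def rr)
      also have "\<dots> = \<phi> (conv \<mu> (r h) (r f)) - \<phi> (conv \<mu> (r f) (r h))"
        using E r1 fh by blast
      also have "\<dots> = \<phi> (r (conv \<mu> f h)) - \<phi> (r (conv \<mu> h f))"
        using fh by (simp add: conv_r L1m)
      finally show "D f h = (- 1) * \<phi> (r (conv \<mu> h f)) - (- 1) * \<phi> (r (conv \<mu> f h))"
        by simp
    qed
  qed
qed

end

theorem theorem3p8:
  fixes \<mu> :: "'a::{t2_space, group_add} measure" and \<omega> :: "'a \<Rightarrow> real"
  assumes "locally_compact_group TYPE('a)"
    and "left_haar_measure \<mu>"
    and "weight_function \<omega>"
  shows "weakly_amenable_L1 \<mu> (\<lambda>x. \<omega> (- x)) \<longleftrightarrow> weakly_amenable_L1 \<mu> \<omega>"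
proof -
  interpret haar_measure \<mu>
    using assms by unfold_locales
  obtain d where "haar_measure_modular \<mu> d"
    using modular_function_exists by blast
  then interpret haar_measure_modular \<mu> d .
  have "0 \<le> \<omega> x" for x
    using assms(3) order_trans[OF zero_le_one] by (auto simp: weight_function_def)
  then show ?thesis
    using weakly_amenable_reflect[of \<omega>] weakly_amenable_reflect[of "\<lambda>x. \<omega> (- x)"] by auto
qed

end
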